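(* Let $T$ be a nice endofunctor on $\mathbf{Top}$. Let $(p_{ij} \colon X_j \to X_i)_{i \sqsubseteq j \in I}$ be a projective system of topological spaces which is an ep-system, with canonical projective limit $X, (p_i)_{i\in I}$; let $Z, (q_i)_{i \in I}$ be the canonical projective limit of the projective system $(T p_{ij} \colon T X_j \to T X_i)_{i \sqsubseteq j \in I}$, and let $\varphi \colon TX \to Z$ be the comparison map, namely the unique continuous map such that $q_i \circ \varphi = T p_i$ for every $i \in I$. If $T X_i$ is $T_0$ for every $i \in I$ and $TX$ is a monotone convergence space, then $\varphi$ is a homeomorphism.
   Context: $\mathbf{Top}$ is the category of topological spaces and continuous maps, and $\mathcal O X$ is the lattice of open subsets of $X$, ordered by inclusion. The specialization preordering is: $x \leq y$ iff every open neighborhood of $x$ contains $y$. An endofunctor $T$ on $\mathbf{Top}$ is nice iff there is a set $R$ such that, for every topological space $X$, $TX$ has a subbase of open sets $(B_X(r,U))_{r \in R, U \in \mathcal O X}$ such that: (1) for every space $X$ and every $r \in R$, the map $U \mapsto B_X(r,U)$ is Scott-continuous (monotonic and preserving directed suprema) from $\mathcal O X$ to $\mathcal O(TX)$; (2) for every continuous map $f \colon X \to Y$, every $r \in R$ and every $V \in \mathcal O Y$, $(Tf)^{-1}(B_Y(r,V)) = B_X(r, f^{-1}(V))$. A projective system $(p_{ij} \colon X_j \to X_i)_{i \sqsubseteq j \in I}$ consists of a directed preordered set $(I,\sqsubseteq)$, spaces $X_i$, and continuous maps $p_{ij}$ ($i \sqsubseteq j$) with $p_{ii} = \mathrm{id}$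 and $p_{ij} \circ p_{jk} = p_{ik}$ for $i \sqsubseteq j \sqsubseteq k$. Its canonical projective limit is $X = \{\vec x \in \prod_{i} X_i \mid p_{ij}(x_j) = x_i \text{ for all } i \sqsubseteq j\}$ with the subspace topology of the product, $p_i$ being projection onto coordinate $i$. The projective system is an ep-system iff there are continuous maps $e_{ij} \colon X_i \to X_j$ ($i \sqsubseteq j$) with $p_{ij} \circ e_{ij} = \mathrm{id}_{X_i}$, $e_{ij} \circ p_{ij} \leq \mathrm{id}_{X_j}$ (pointwise, in the specialization preordering of $X_j$), $e_{ii} = \mathrm{id}$, and $e_{jk} \circ e_{ij} = e_{ik}$ for $i \sqsubseteq j \sqsubseteq k$. A monotone convergence space is a $T_0$ space that is a dcpo (every directed family has a supremum) in its specialization ordering and whose topology is coarser than (i.e., included in) the Scott topology of that ordering. *)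

theory Defs
  imports "HOL-Analysis.Analysis"
begin

section \<open>Directed sets, specialization, monotone convergence\<close>

definition directed_set :: "('a \<Rightarrow> 'a \<Rightarrow> bool) \<Rightarrow> 'a set \<Rightarrow> bool" where
  "directed_set le D \<longleftrightarrow> D \<noteq> {} \<and> (\<forall>x\<in>D. \<forall>y\<in>D. \<exists>z\<in>D. le x z \<and> le y z)"

definition is_supremum :: "'a set \<Rightarrow> ('a \<Rightarrow> 'a \<Rightarrow> bool) \<Rightarrow> 'a set \<Rightarrow> 'a \<Rightarrow> bool" where
  "is_supremum C le D s \<longleftrightarrow>
     s \<in> C \<and> (\<forall>d\<in>D. le d s) \<and> (\<forall>u\<in>C. (\<forall>d\<in>D. le d u) \<longrightarrow> le s u)"

definition scott_open :: "'a set \<Rightarrow> ('a \<Rightarrow> 'a \<Rightarrow> bool) \<Rightarrow> 'a set \<Rightarrow> bool" where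
  "scott_open C le U \<longleftrightarrow>
     U \<subseteq> C \<and>
     (\<forall>x\<in>U. \<forall>y\<in>C. le x y \<longrightarrow> y \<in> U) \<and>
     (\<forall>D s. D \<subseteq> C \<and> directed_set le D \<and> is_supremum C le D s \<and> s \<in> U \<longrightarrow> D \<inter> U \<noteq> {})"

definition specialization :: "'a topology \<Rightarrow> 'a \<Rightarrow> 'a \<Rightarrow> bool" where
  "specialization X x y \<longleftrightarrow>
     x \<in> topspace X \<and> y \<in> topspace X \<and> (\<forall>U. openin X U \<and> x \<in> U \<longrightarrow> y \<in> U)"

definition monotone_convergence_space :: "'a topology \<Rightarrow> bool" where
  "monotone_convergence_space X \<longleftrightarrow>
     t0_space X \<and>
     (\<forall>D. D \<subseteq> topspace X \<and> directed_set (specialization X) D \<longrightarrow>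
          (\<exists>s. is_supremum (topspace X) (specialization X) D s)) \<and>
     (\<forall>U. openin X U \<longrightarrow> scott_open (topspace X) (specialization X) U)"


section \<open>Functors on topological spaces\<close>

text \<open>
  HOL cannot quantify over all types, so the spaces that a functor is applied to are all
  \<^typ>\<open>'u topology\<close> for an arbitrary type \<^typ>\<open>'u\<close>, the topspace being an arbitrary
  subset of \<^typ>\<open>'u\<close>. The values live in a second arbitrary type \<^typ>\<open>'v\<close>. Taking
  \<^typ>\<open>'v\<close> to be \<^typ>\<open>'u\<close> gives endofunctors in the literal sense, but that alone would
  exclude, for reasons of cardinality, functors such as hyperspaces, whose values have
  more points than their arguments; an endofunctor of the category of all topological
  spaces restricts to a functor of the present kind for each \<^typ>\<open>'u\<close> and a suitable
  \<^typ>\<open>'v\<close>.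

  The object part of a functor is \<open>T\<close>, and its value on a morphism \<open>f : X \<rightarrow> Y\<close> is
  \<open>Tm X Y f\<close>. A morphism is a HOL function considered only on the topspace of its domain,
  hence the second clause.
\<close>

definition top_functor ::
  "('u topology \<Rightarrow> 'v topology) \<Rightarrow>
   ('u topology \<Rightarrow> 'u topology \<Rightarrow> ('u \<Rightarrow> 'u) \<Rightarrow> 'v \<Rightarrow> 'v) \<Rightarrow> bool" where
  "top_functor T Tm \<longleftrightarrow>
     (\<forall>X Y f. continuous_map X Y f \<longrightarrow> continuous_map (T X) (T Y) (Tm X Y f)) \<and>
     (\<forall>X Y f g. continuous_map X Y f \<and> continuous_map X Y g \<and> (\<forall>x\<in>topspace X. f x = g x) \<longrightarrow>
        (\<forall>z\<in>topspace (T X). Tm X Y f z = Tm X Y g z)) \<and>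
     (\<forall>X. \<forall>z\<in>topspace (T X). Tm X X id z = z) \<and>
     (\<forall>X Y Z f g. continuous_map X Y f \<and> continuous_map Y Z g \<longrightarrow>
        (\<forall>z\<in>topspace (T X). Tm X Z (g \<circ> f) z = Tm Y Z g (Tm X Y f z)))"

text \<open>The whole space counts as the empty intersection of subbasic open sets.\<close>

definition is_subbase :: "'a topology \<Rightarrow> 'a set set \<Rightarrow> bool" where
  "is_subbase X \<S> \<longleftrightarrow>
     (\<forall>V\<in>\<S>. openin X V) \<and>
     openin X = arbitrary union_of (finite intersection_of (\<lambda>V. V \<in> \<S>) relative_to topspace X)"

text \<open>In a lattice of open sets, suprema are unions.\<close>

definition scott_continuous_opens ::
  "'a topology \<Rightarrow> 'b topology \<Rightarrow> ('a set \<Rightarrow> 'b set) \<Rightarrow> bool" where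
  "scott_continuous_opens X Y b \<longleftrightarrow>
     (\<forall>U. openin X U \<longrightarrow> openin Y (b U)) \<and>
     (\<forall>U V. openin X U \<and> openin X V \<and> U \<subseteq> V \<longrightarrow> b U \<subseteq> b V) \<and>
     (\<forall>\<D>. (\<forall>U\<in>\<D>. openin X U) \<and> directed_set (\<subseteq>) \<D> \<longrightarrow> b (\<Union>\<D>) = (\<Union>U\<in>\<D>. b U))"

text \<open>
  The index set \<open>R\<close> is a parameter, because its type cannot be existentially quantified.
\<close>

definition nice_functor ::
  "('u topology \<Rightarrow> 'v topology) \<Rightarrow>
   ('u topology \<Rightarrow> 'u topology \<Rightarrow> ('u \<Rightarrow> 'u) \<Rightarrow> 'v \<Rightarrow> 'v) \<Rightarrow> 'r set \<Rightarrow> bool" where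
  "nice_functor T Tm R \<longleftrightarrow>
     top_functor T Tm \<and>
     (\<exists>B :: 'u topology \<Rightarrow> 'r \<Rightarrow> 'u set \<Rightarrow> 'v set.
        (\<forall>X. is_subbase (T X) {B X r U |r U. r \<in> R \<and> openin X U}) \<and>
        (\<forall>X. \<forall>r\<in>R. scott_continuous_opens X (T X) (B X r)) \<and>
        (\<forall>X Y f. continuous_map X Y f \<longrightarrow>
           (\<forall>r\<in>R. \<forall>V. openin Y V \<longrightarrow>
              {z \<in> topspace (T X). Tm X Y f z \<in> B Y r V} = B X r {x \<in> topspace X. f x \<in> V})))"


section \<open>Projective systems and their limits\<close>

text \<open>\<open>p i j\<close> is the bonding map from \<open>X j\<close> to \<open>X i\<close>, for \<open>le i j\<close>.\<close>

definition projective_system ::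
  "'i set \<Rightarrow> ('i \<Rightarrow> 'i \<Rightarrow> bool) \<Rightarrow> ('i \<Rightarrow> 'a topology) \<Rightarrow> ('i \<Rightarrow> 'i \<Rightarrow> 'a \<Rightarrow> 'a) \<Rightarrow> bool" where
  "projective_system I le X p \<longleftrightarrow>
     reflp_on I le \<and> transp_on I le \<and> directed_set le I \<and>
     (\<forall>i\<in>I. \<forall>j\<in>I. le i j \<longrightarrow> continuous_map (X j) (X i) (p i j)) \<and>
     (\<forall>i\<in>I. \<forall>x\<in>topspace (X i). p i i x = x) \<and>
     (\<forall>i\<in>I. \<forall>j\<in>I. \<forall>k\<in>I. le i j \<and> le j k \<longrightarrow>
        (\<forall>x\<in>topspace (X k). p i j (p j k x) = p i k x))"

text \<open>\<open>e i j\<close> goes from \<open>X i\<close> to \<open>X j\<close>, for \<open>le i j\<close>.\<close>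

definition ep_system ::
  "'i set \<Rightarrow> ('i \<Rightarrow> 'i \<Rightarrow> bool) \<Rightarrow> ('i \<Rightarrow> 'a topology) \<Rightarrow> ('i \<Rightarrow> 'i \<Rightarrow> 'a \<Rightarrow> 'a) \<Rightarrow> bool" where
  "ep_system I le X p \<longleftrightarrow>
     projective_system I le X p \<and>
     (\<exists>e :: 'i \<Rightarrow> 'i \<Rightarrow> 'a \<Rightarrow> 'a.
        (\<forall>i\<in>I. \<forall>j\<in>I. le i j \<longrightarrow>
           continuous_map (X i) (X j) (e i j) \<and>
           (\<forall>x\<in>topspace (X i). p i j (e i j x) = x) \<and>
           (\<forall>x\<in>topspace (X j). specialization (X j) (e i j (p i j x)) x)) \<and>
        (\<forall>i\<in>I. \<forall>x\<in>topspace (X i). e i i x = x) \<and>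
        (\<forall>i\<in>I. \<forall>j\<in>I. \<forall>k\<in>I. le i j \<and> le j k \<longrightarrow>
           (\<forall>x\<in>topspace (X i). e j k (e i j x) = e i k x)))"

definition proj_limit ::
  "'i set \<Rightarrow> ('i \<Rightarrow> 'i \<Rightarrow> bool) \<Rightarrow> ('i \<Rightarrow> 'a topology) \<Rightarrow> ('i \<Rightarrow> 'i \<Rightarrow> 'a \<Rightarrow> 'a) \<Rightarrow>
   ('i \<Rightarrow> 'a) topology" where
  "proj_limit I le X p =
     subtopology (product_topology X I) {x. \<forall>i\<in>I. \<forall>j\<in>I. le i j \<longrightarrow> p i j (x j) = x i}"

text \<open>
  The points of \<^const>\<open>proj_limit\<close> have type \<^typ>\<open>'i \<Rightarrow> 'a\<close>, but a functor given on
  \<^typ>\<open>'a topology\<close> applies only to spaces with points in \<^typ>\<open>'a\<close>. So the canonical limit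
  is handed to the functor through a copy \<open>L\<close> with points in \<^typ>\<open>'a\<close>, the points being
  renamed by a homeomorphism under which the coordinate projections become the maps
  \<open>\<pi> i\<close>. By \<open>proj_limit_copy_exists\<close> below, the type \<^typ>\<open>'a\<close> only has to be large enough
  to name the points of the limit.
\<close>

definition proj_limit_copy ::
  "'i set \<Rightarrow> ('i \<Rightarrow> 'i \<Rightarrow> bool) \<Rightarrow> ('i \<Rightarrow> 'a topology) \<Rightarrow> ('i \<Rightarrow> 'i \<Rightarrow> 'a \<Rightarrow> 'a) \<Rightarrow>
   'a topology \<Rightarrow> ('i \<Rightarrow> 'a \<Rightarrow> 'a) \<Rightarrow> bool" where
  "proj_limit_copy I le X p L \<pi> \<longleftrightarrow>
     homeomorphic_map L (proj_limit I le X p) (\<lambda>u. \<lambda>i\<in>I. \<pi> i u)"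

lemma topspace_proj_limit:
  "topspace (proj_limit I le X p) =
     {x \<in> (\<Pi>\<^sub>E i\<in>I. topspace (X i)). \<forall>i\<in>I. \<forall>j\<in>I. le i j \<longrightarrow> p i j (x j) = x i}"
  by (auto simp: proj_limit_def)

lemma proj_limit_copy_exists:
  fixes enc :: "('i \<Rightarrow> 'a) \<Rightarrow> 'a"
  assumes "inj_on enc (topspace (proj_limit I le X p))"
  shows "\<exists>L \<pi>. proj_limit_copy I le X p L \<pi>"
proof -
  let ?P = "proj_limit I le X p"
  define dec where "dec = inv_into (topspace ?P) enc"
  define L where "L = pullback_topology (enc ` topspace ?P) dec ?P"
  have dec: "dec (enc x) = x" if "x \<in> topspace ?P" for x
    using that assms by (simp add: dec_def)
  have top: "topspace L = enc ` topspace ?P"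
    using dec by (auto simp: L_def topspace_pullback_topology)
  have c1: "continuous_map L ?P dec"
    unfolding L_def using continuous_map_pullback [of ?P ?P id] by (simp add: o_def)
  have c2: "continuous_map ?P L enc"
    unfolding L_def
  proof (rule continuous_map_pullback')
    show "continuous_map ?P ?P (dec \<circ> enc)"
      by (rule continuous_map_eq [of _ _ id]) (auto simp: dec)
  qed auto
  have "homeomorphic_maps L ?P dec enc"
    using c1 c2 by (auto simp: homeomorphic_maps_def top dec)
  then have "homeomorphic_map L ?P dec"
    using homeomorphic_map_maps by blast
  moreover have "dec u = (\<lambda>i\<in>I. dec u i)" if "u \<in> topspace L" for u
  proof -
    have "dec u \<in> topspace ?P"
      using that dec by (auto simp: top)
    then show ?thesis
      by (auto simp: topspace_proj_limit PiE_def extensional_restrict)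
  qed
  ultimately have "homeomorphic_map L ?P (\<lambda>u. \<lambda>i\<in>I. (\<lambda>i u. dec u i) i u)"
    by (metis (no_types, lifting) homeomorphic_map_eq)
  then show ?thesis
    unfolding proj_limit_copy_def by (intro exI [of _ L] exI [of _ "\<lambda>i u. dec u i"])
qed

text \<open>
  The limit of the image system is a literal \<^const>\<open>proj_limit\<close>, so its projections are
  evaluations at \<open>i\<close>.
\<close>

definition image_limit ::
  "('u topology \<Rightarrow> 'v topology) \<Rightarrow>
   ('u topology \<Rightarrow> 'u topology \<Rightarrow> ('u \<Rightarrow> 'u) \<Rightarrow> 'v \<Rightarrow> 'v) \<Rightarrow>
   'i set \<Rightarrow> ('i \<Rightarrow> 'i \<Rightarrow> bool) \<Rightarrow> ('i \<Rightarrow> 'u topology) \<Rightarrow> ('i \<Rightarrow> 'i \<Rightarrow> 'u \<Rightarrow> 'u) \<Rightarrow>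
   ('i \<Rightarrow> 'v) topology" where
  "image_limit T Tm I le X p =
     proj_limit I le (\<lambda>i. T (X i)) (\<lambda>i j. Tm (X j) (X i) (p i j))"

definition comparison_map ::
  "('u topology \<Rightarrow> 'v topology) \<Rightarrow>
   ('u topology \<Rightarrow> 'u topology \<Rightarrow> ('u \<Rightarrow> 'u) \<Rightarrow> 'v \<Rightarrow> 'v) \<Rightarrow>
   'i set \<Rightarrow> ('i \<Rightarrow> 'i \<Rightarrow> bool) \<Rightarrow> ('i \<Rightarrow> 'u topology) \<Rightarrow> ('i \<Rightarrow> 'i \<Rightarrow> 'u \<Rightarrow> 'u) \<Rightarrow>
   'u topology \<Rightarrow> ('i \<Rightarrow> 'u \<Rightarrow> 'u) \<Rightarrow> ('v \<Rightarrow> 'i \<Rightarrow> 'v) \<Rightarrow> bool" where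
  "comparison_map T Tm I le X p L \<pi> \<phi> \<longleftrightarrow>
     continuous_map (T L) (image_limit T Tm I le X p) \<phi> \<and>
     (\<forall>i\<in>I. \<forall>z\<in>topspace (T L). \<phi> z i = Tm L (X i) (\<pi> i) z)"

lemma comparison_map_exists:
  assumes T: "top_functor T Tm" and p: "projective_system I le X p"
    and L: "proj_limit_copy I le X p L \<pi>"
  shows "comparison_map T Tm I le X p L \<pi> (\<lambda>z. \<lambda>i\<in>I. Tm L (X i) (\<pi> i) z)"
proof -
  let ?h = "\<lambda>u. \<lambda>i\<in>I. \<pi> i u"
  have h: "continuous_map L (proj_limit I le X p) ?h"
    using L by (simp add: proj_limit_copy_def homeomorphic_imp_continuous_map)
  have mem: "?h u \<in> topspace (proj_limit I le X p)" if "u \<in> topspace L" for u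
    using h that by (auto simp: continuous_map_def Pi_iff)
  have \<pi>: "continuous_map L (X i) (\<pi> i)" if "i \<in> I" for i
    using h that
    by (auto simp: proj_limit_def continuous_map_in_subtopology continuous_map_componentwise)
  have p\<pi>: "p i j (\<pi> j u) = \<pi> i u"
    if "i \<in> I" "j \<in> I" "le i j" "u \<in> topspace L" for i j u
    using mem [OF that(4)] that by (auto simp: topspace_proj_limit)
  have T\<pi>: "continuous_map (T L) (T (X i)) (Tm L (X i) (\<pi> i))" if "i \<in> I" for i
    using T \<pi> [OF that] by (simp add: top_functor_def)
  have coh: "Tm (X j) (X i) (p i j) (Tm L (X j) (\<pi> j) z) = Tm L (X i) (\<pi> i) z"
    if ij: "i \<in> I" "j \<in> I" "le i j" and z: "z \<in> topspace (T L)" for i j z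
  proof -
    have c: "continuous_map (X j) (X i) (p i j)"
      using p ij by (auto simp: projective_system_def)
    have "Tm (X j) (X i) (p i j) (Tm L (X j) (\<pi> j) z) = Tm L (X i) (p i j \<circ> \<pi> j) z"
      using T c \<pi> [OF ij(2)] z unfolding top_functor_def by metis
    also have "\<dots> = Tm L (X i) (\<pi> i) z"
    proof -
      have "continuous_map L (X i) (p i j \<circ> \<pi> j)"
        using c \<pi> [OF ij(2)] by (rule continuous_map_compose [rotated])
      moreover have "\<forall>u\<in>topspace L. (p i j \<circ> \<pi> j) u = \<pi> i u"
        using p\<pi> ij by simp
      ultimately show ?thesis
        using T \<pi> [OF ij(1)] z unfolding top_functor_def by blast
    qed
    finally show ?thesis .
  qed
  have "continuous_map (T L) (image_limit T Tm I le X p) (\<lambda>z. \<lambda>i\<in>I. Tm L (X i) (\<pi> i) z)"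
    using T\<pi> coh
    by (auto simp: image_limit_def proj_limit_def continuous_map_in_subtopology
        continuous_map_componentwise)
  then show ?thesis
    by (simp add: comparison_map_def)
qed

lemma comparison_map_unique:
  assumes "comparison_map T Tm I le X p L \<pi> \<phi>" "comparison_map T Tm I le X p L \<pi> \<psi>"
    and z: "z \<in> topspace (T L)"
  shows "\<phi> z = \<psi> z"
proof -
  have "\<phi> z \<in> topspace (image_limit T Tm I le X p)" "\<psi> z \<in> topspace (image_limit T Tm I le X p)"
    using assms by (auto simp: comparison_map_def continuous_map_def)
  then have "\<phi> z \<in> extensional I" "\<psi> z \<in> extensional I"
    by (auto simp: image_limit_def topspace_proj_limit PiE_def)
  moreover have "\<phi> z i = \<psi> z i" if "i \<in> I" for i
    using assms that by (simp add: comparison_map_def)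
  ultimately show ?thesis
    by (rule extensionalityI)
qed

end

theory Submission
  imports Defs
begin

text \<open>
  Write \<open>\<le>\<close> for specialization. Two facts carry the proof: an ep-system has embeddings
  \<open>\<epsilon> i : X i \<rightarrow> L\<close> into its limit, and a nice functor is monotone, that is, \<open>f \<le> g\<close> implies
  \<open>T f \<le> T g\<close> (\<open>nice_functor_mono\<close>). The embeddings satisfy \<open>\<pi> i \<circ> \<epsilon> i = id\<close>, \<open>\<epsilon> i \<circ> \<pi> i \<le> id\<close> and
  \<open>\<epsilon> i \<circ> p i j \<le> \<epsilon> j\<close> (\<open>ep_system_limit_embeddings\<close>). The first fact makes \<open>\<phi>\<close> an
  embedding, and the two together make it onto.

  The map \<open>\<phi>\<close> induces the topology of \<open>T L\<close>. Every open \<open>U\<close> in \<open>L\<close> is the directed union over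
  \<open>i\<close> of the preimages of \<open>U\<close> under \<open>\<epsilon> i \<circ> \<pi> i\<close> (\<open>open_eq_directed_Union\<close>), hence of preimages
  under \<open>\<pi> i\<close> of open sets \<open>V i\<close>. By Scott-continuity the operator \<open>B L r\<close> passes
  through this union, and by naturality it turns preimages under \<open>\<pi> i\<close> into preimages under
  \<open>T (\<pi> i)\<close>, which is \<open>\<phi>\<close> followed by the \<open>i\<close>-th projection. So the subbasic open sets of \<open>T L\<close>
  are preimages under \<open>\<phi>\<close> of open sets (\<open>T_limit_initial_subbase\<close>), and as \<open>T L\<close> is \<open>T\<^sub>0\<close>, it
  follows that \<open>\<phi>\<close> is a topological embedding.

  The map \<open>\<phi>\<close> is onto (\<open>image_limit_has_preimage\<close>). Given \<open>z\<close> in the limit of the \<open>T (X i)\<close>, the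
  points \<open>T (\<epsilon> i) (z i)\<close> form a directed family, by monotonicity of \<open>T\<close> and the third law, so they
  have a supremum \<open>s\<close>. For \<open>j\<close> above \<open>i\<close>, the map \<open>T (\<pi> i)\<close> sends the \<open>j\<close>-th of them to \<open>z i\<close>. As
  open sets of \<open>T L\<close> are Scott-open, continuity of \<open>T (\<pi> i)\<close> makes the value at \<open>s\<close> equivalent to
  \<open>z i\<close> for specialization, and \<open>T (X i)\<close> being \<open>T\<^sub>0\<close> turns equivalence into equality.
\<close>

section \<open>Specialization, subbases and directed sets\<close>

lemma specialization_antisym:
  assumes "t0_space X" "specialization X x y" "specialization X y x"
  shows "x = y"
proof (rule ccontr)
  assume "x \<noteq> y"
  moreover have "x \<in> topspace X" "y \<in> topspace X"
    using assms(2) by (simp_all add: specialization_def)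
  ultimately obtain U where "openin X U" "x \<notin> U \<longleftrightarrow> y \<in> U"
    using assms(1) unfolding t0_space_def by blast
  then show False
    using assms(2,3) by (auto simp: specialization_def)
qed

lemma specialization_continuous_map:
  assumes f: "continuous_map X Y f" and xy: "specialization X x y"
  shows "specialization Y (f x) (f y)"
  unfolding specialization_def
proof (intro conjI allI impI)
  show "f x \<in> topspace Y" "f y \<in> topspace Y"
    using f xy by (auto simp: specialization_def continuous_map_def)
  show "f y \<in> V" if "openin Y V \<and> f x \<in> V" for V
  proof -
    have "openin X {u \<in> topspace X. f u \<in> V}"
      using f that by (simp add: continuous_map_def)
    then show ?thesis
      using that xy by (auto simp: specialization_def)
  qed
qed

lemma specializationD: "specialization X x y \<Longrightarrow> openin X U \<Longrightarrow> x \<in> U \<Longrightarrow> y \<in> U"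
  by (simp add: specialization_def)

lemma scott_open_meets:
  assumes U: "scott_open C le U" and D: "D \<subseteq> C" "directed_set le D" "is_supremum C le D s" "s \<in> U"
  obtains d where "d \<in> D" "d \<in> U"
proof -
  have "\<forall>D s. D \<subseteq> C \<and> directed_set le D \<and> is_supremum C le D s \<and> s \<in> U \<longrightarrow> D \<inter> U \<noteq> {}"
    using U unfolding scott_open_def by (elim conjE)
  from spec [OF spec [OF this]] D have "D \<inter> U \<noteq> {}"
    by blast
  then show thesis
    using that by blast
qed

lemma subbase_neighbourhood:
  assumes S: "is_subbase X \<S>" and U: "openin X U" "x \<in> U"
  obtains F where "finite F" "F \<subseteq> \<S>" "x \<in> \<Inter>F" "topspace X \<inter> \<Inter>F \<subseteq> U"
proof -
  have "(arbitrary union_of (finite intersection_of (\<lambda>V. V \<in> \<S>) relative_to topspace X)) U"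
    using S U by (simp add: is_subbase_def)
  then obtain W where "(finite intersection_of (\<lambda>V. V \<in> \<S>) relative_to topspace X) W"
    "x \<in> W" "W \<subseteq> U"
    using U(2) by (auto simp: union_of_def)
  then obtain F where "finite F" "F \<subseteq> \<S>" "topspace X \<inter> \<Inter>F = W"
    by (auto simp: relative_to_def intersection_of_def)
  with \<open>x \<in> W\<close> \<open>W \<subseteq> U\<close> show thesis
    using that by blast
qed

lemma specialization_subbaseI:
  assumes S: "is_subbase X \<S>" and x: "x \<in> topspace X" and y: "y \<in> topspace X"
    and xy: "\<And>V. V \<in> \<S> \<Longrightarrow> x \<in> V \<Longrightarrow> y \<in> V"
  shows "specialization X x y"
  unfolding specialization_def
proof (intro conjI allI impI x y)
  fix U assume "openin X U \<and> x \<in> U"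
  then obtain F where "F \<subseteq> \<S>" "x \<in> \<Inter>F" "topspace X \<inter> \<Inter>F \<subseteq> U"
    using subbase_neighbourhood [OF S] by metis
  with xy y show "y \<in> U"
    by blast
qed

lemma continuous_map_into_subbase:
  assumes S: "is_subbase Y \<S>" and f: "f \<in> topspace X \<rightarrow> topspace Y"
    and pre: "\<And>V. V \<in> \<S> \<Longrightarrow> openin X {x \<in> topspace X. f x \<in> V}"
  shows "continuous_map X Y f"
proof -
  have "openin Y = arbitrary union_of (finite intersection_of (\<lambda>V. V \<in> \<S>) relative_to topspace Y)"
    using S by (simp add: is_subbase_def)
  then show ?thesis
    using continuous_map_into_topology_subbase_eq [of Y "\<lambda>V. V \<in> \<S>" "topspace Y" X f]
    by (metis f pre topology_inverse' openin_inverse)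
qed

lemma directed_set_finite_bound:
  assumes I: "directed_set le I" "transp_on I le" and F: "finite F" "F \<subseteq> I"
  obtains k where "k \<in> I" "\<And>i. i \<in> F \<Longrightarrow> le i k"
proof -
  have "\<exists>k\<in>I. \<forall>i\<in>F. le i k"
    using F
  proof (induction F)
    case empty
    then show ?case
      using I by (auto simp: directed_set_def)
  next
    case (insert a F)
    then obtain k where k: "k \<in> I" "\<forall>i\<in>F. le i k"
      by blast
    moreover obtain m where m: "m \<in> I" "le a m" "le k m"
      using I(1) k(1) insert.prems unfolding directed_set_def by blast
    ultimately have "\<forall>i\<in>insert a F. le i m"
      using I(2) insert.prems by (auto dest: transp_onD)
    with m(1) show ?case
      by blast
  qed
  then show thesis
    using that by blast
qed


section \<open>Limits of projective systems\<close>

lemma projective_system_continuous: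
  "projective_system I le X p \<Longrightarrow> i \<in> I \<Longrightarrow> j \<in> I \<Longrightarrow> le i j \<Longrightarrow> continuous_map (X j) (X i) (p i j)"
  by (simp add: projective_system_def)

lemma projective_system_comp:
  assumes "projective_system I le X p" "i \<in> I" "j \<in> I" "k \<in> I" "le i j" "le j k"
    and "x \<in> topspace (X k)"
  shows "p i j (p j k x) = p i k x"
proof -
  have "\<forall>i\<in>I. \<forall>j\<in>I. \<forall>k\<in>I. le i j \<and> le j k \<longrightarrow> (\<forall>x\<in>topspace (X k). p i j (p j k x) = p i k x)"
    using assms(1) unfolding projective_system_def by (elim conjE)
  from this [rule_format, OF assms(2-4) _ assms(7)] assms(5,6) show ?thesis
    by blast
qed

lemma projective_system_upper_bound:
  assumes "projective_system I le X p" "i \<in> I" "j \<in> I"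
  obtains k where "k \<in> I" "le i k" "le j k"
  using assms unfolding projective_system_def directed_set_def by blast

lemma proj_limit_copy_continuous:
  assumes L: "proj_limit_copy I le X p L \<pi>" and i: "i \<in> I"
  shows "continuous_map L (X i) (\<pi> i)"
proof -
  have "continuous_map L (proj_limit I le X p) (\<lambda>u. \<lambda>i\<in>I. \<pi> i u)"
    using L by (simp add: proj_limit_copy_def homeomorphic_imp_continuous_map)
  then show ?thesis
    using i by (auto simp: proj_limit_def continuous_map_in_subtopology continuous_map_componentwise)
qed

lemma proj_limit_copy_cone:
  assumes L: "proj_limit_copy I le X p L \<pi>"
    and ij: "i \<in> I" "j \<in> I" "le i j" and u: "u \<in> topspace L"
  shows "p i j (\<pi> j u) = \<pi> i u"
proof -
  have "continuous_map L (proj_limit I le X p) (\<lambda>u. \<lambda>i\<in>I. \<pi> i u)"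
    using L by (simp add: proj_limit_copy_def homeomorphic_imp_continuous_map)
  then have "(\<lambda>i\<in>I. \<pi> i u) \<in> topspace (proj_limit I le X p)"
    using u by (auto simp: continuous_map_def)
  then show ?thesis
    using ij by (auto simp: topspace_proj_limit)
qed

lemma proj_limit_copy_lift:
  assumes L: "proj_limit_copy I le X p L \<pi>"
    and f: "\<And>i. i \<in> I \<Longrightarrow> continuous_map Y (X i) (f i)"
    and pf: "\<And>i j y. i \<in> I \<Longrightarrow> j \<in> I \<Longrightarrow> le i j \<Longrightarrow> y \<in> topspace Y \<Longrightarrow> p i j (f j y) = f i y"
  obtains h where "continuous_map Y L h" "\<And>i y. i \<in> I \<Longrightarrow> y \<in> topspace Y \<Longrightarrow> \<pi> i (h y) = f i y"
proof -
  let ?P = "proj_limit I le X p"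
  obtain g where g: "homeomorphic_maps L ?P (\<lambda>u. \<lambda>i\<in>I. \<pi> i u) g"
    using L by (auto simp: proj_limit_copy_def homeomorphic_map_maps)
  have F: "continuous_map Y ?P (\<lambda>y. \<lambda>i\<in>I. f i y)"
    using f pf by (auto simp: proj_limit_def continuous_map_in_subtopology continuous_map_componentwise)
  have "continuous_map Y L (g \<circ> (\<lambda>y. \<lambda>i\<in>I. f i y))"
    using F g by (auto simp: homeomorphic_maps_def intro: continuous_map_compose)
  moreover have "\<pi> i ((g \<circ> (\<lambda>y. \<lambda>i\<in>I. f i y)) y) = f i y" if "i \<in> I" "y \<in> topspace Y" for i y
  proof -
    have "(\<lambda>i\<in>I. f i y) \<in> topspace ?P"
      using F that by (auto simp: continuous_map_def)
    then have "(\<lambda>i\<in>I. \<pi> i (g (\<lambda>i\<in>I. f i y))) = (\<lambda>i\<in>I. f i y)"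
      using g by (simp add: homeomorphic_maps_def)
    from fun_cong [OF this, of i] that show ?thesis
      by simp
  qed
  ultimately show thesis
    using that by blast
qed

text \<open>
  A neighbourhood in a product constrains finitely many coordinates. In a limit over a directed
  index set one coordinate is enough: take \<open>k\<close> above all the constrained indices and pull the
  constraints back to \<open>X k\<close> along the bonding maps.
\<close>

lemma proj_limit_copy_neighbourhood:
  assumes p: "projective_system I le X p" and L: "proj_limit_copy I le X p L \<pi>"
    and U: "openin L U" "u \<in> U"
  obtains i V where "i \<in> I" "openin (X i) V" "\<pi> i u \<in> V" "{w \<in> topspace L. \<pi> i w \<in> V} \<subseteq> U"
proof -
  let ?P = "proj_limit I le X p" and ?h = "\<lambda>u. \<lambda>i\<in>I. \<pi> i u"
  have h: "homeomorphic_map L ?P ?h"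
    using L by (simp add: proj_limit_copy_def)
  have sub: "U \<subseteq> topspace L"
    using U by (simp add: openin_subset)
  have "openin ?P (?h ` U)"
    using h U(1) homeomorphic_map_openness [OF h sub] by simp
  then obtain W where W: "openin (product_topology X I) W"
      "?h ` U = W \<inter> {x. \<forall>i\<in>I. \<forall>j\<in>I. le i j \<longrightarrow> p i j (x j) = x i}"
    by (auto simp: proj_limit_def openin_subtopology)
  have "?h u \<in> W"
    using W(2) U(2) by blast
  then obtain B where fin: "finite {i \<in> I. B i \<noteq> topspace (X i)}"
    and B: "\<And>i. i \<in> I \<Longrightarrow> openin (X i) (B i)" "?h u \<in> Pi\<^sub>E I B" "Pi\<^sub>E I B \<subseteq> W"
    using bspec [OF iffD1 [OF openin_product_topology_alt W(1)] \<open>?h u \<in> W\<close>] by blast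
  let ?F = "{i \<in> I. B i \<noteq> topspace (X i)}"
  obtain k where k: "k \<in> I" "\<And>i. i \<in> ?F \<Longrightarrow> le i k"
  proof (rule directed_set_finite_bound [OF _ _ fin])
    show "directed_set le I" "transp_on I le"
      using p by (simp_all add: projective_system_def)
  qed auto
  let ?V = "(\<Inter>i\<in>?F. {x \<in> topspace (X k). p i k x \<in> B i}) \<inter> topspace (X k)"
  have "openin (X k) {x \<in> topspace (X k). p i k x \<in> B i}" if "i \<in> ?F" for i
    using projective_system_continuous [OF p _ k(1) k(2)] that B(1)
    by (auto simp: continuous_map_def)
  then have openV: "openin (X k) ?V"
    by (rule openin_INT [OF fin])
  have \<pi>: "\<pi> i w \<in> topspace (X i)" if "i \<in> I" "w \<in> topspace L" for i w
    using proj_limit_copy_continuous [OF L that(1)] that(2) by (auto simp: continuous_map_def)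
  have mem: "\<pi> k w \<in> ?V \<longleftrightarrow> (\<forall>i\<in>I. \<pi> i w \<in> B i)" if w: "w \<in> topspace L" for w
    using \<pi> [OF _ w] proj_limit_copy_cone [OF L _ k(1) k(2) w] k(1) by auto
  have "\<forall>i\<in>I. \<pi> i u \<in> B i"
    using B(2) by (auto simp: PiE_iff)
  then have "\<pi> k u \<in> ?V"
    using iffD2 [OF mem] sub U(2) by blast
  moreover have "{w \<in> topspace L. \<pi> k w \<in> ?V} \<subseteq> U"
  proof
    fix w assume "w \<in> {w \<in> topspace L. \<pi> k w \<in> ?V}"
    then have w: "w \<in> topspace L" and "\<forall>i\<in>I. \<pi> i w \<in> B i"
      using mem by auto
    then have "?h w \<in> W"
      using B(3) by auto
    moreover have "p i j (?h w j) = ?h w i" if "i \<in> I" "j \<in> I" "le i j" for i j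
      using proj_limit_copy_cone [OF L that w] that by simp
    ultimately have "?h w \<in> ?h ` U"
      using W(2) by blast
    then show "w \<in> U"
      using inj_on_image_mem_iff [OF homeomorphic_imp_injective_map [OF h] w sub] by blast
  qed
  ultimately show thesis
    using that k(1) openV by blast
qed

lemma specialization_proj_limit_copyI:
  assumes p: "projective_system I le X p" and L: "proj_limit_copy I le X p L \<pi>"
    and uw: "u \<in> topspace L" "w \<in> topspace L"
    and \<pi>: "\<And>i. i \<in> I \<Longrightarrow> specialization (X i) (\<pi> i u) (\<pi> i w)"
  shows "specialization L u w"
  unfolding specialization_def
proof (intro conjI allI impI uw)
  fix U assume U: "openin L U \<and> u \<in> U"
  obtain i V where "i \<in> I" "openin (X i) V" "\<pi> i u \<in> V" "{w \<in> topspace L. \<pi> i w \<in> V} \<subseteq> U"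
    using proj_limit_copy_neighbourhood [OF p L conjunct1 [OF U] conjunct2 [OF U]] .
  with \<pi> uw(2) show "w \<in> U"
    by (auto simp: specialization_def)
qed


section \<open>Embeddings into the limit of an ep-system\<close>

text \<open>
  This is an ep-system in which the limit has been added as a largest index: \<open>\<epsilon> i\<close> is the
  embedding that goes with the projection \<open>\<pi> i\<close>. The law
  \<open>\<epsilon> i = \<epsilon> j \<circ> e i j\<close> is replaced by its consequence \<open>\<epsilon> i \<circ> p i j \<le> \<epsilon> j\<close>, which no longer
  mentions \<open>e\<close>.
\<close>

definition limit_embeddings ::
  "'i set \<Rightarrow> ('i \<Rightarrow> 'i \<Rightarrow> bool) \<Rightarrow> ('i \<Rightarrow> 'a topology) \<Rightarrow> ('i \<Rightarrow> 'i \<Rightarrow> 'a \<Rightarrow> 'a) \<Rightarrow>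
   'a topology \<Rightarrow> ('i \<Rightarrow> 'a \<Rightarrow> 'a) \<Rightarrow> ('i \<Rightarrow> 'a \<Rightarrow> 'a) \<Rightarrow> bool" where
  "limit_embeddings I le X p L \<pi> \<epsilon> \<longleftrightarrow>
     (\<forall>i\<in>I. continuous_map (X i) L (\<epsilon> i) \<and>
        (\<forall>x\<in>topspace (X i). \<pi> i (\<epsilon> i x) = x) \<and>
        (\<forall>u\<in>topspace L. specialization L (\<epsilon> i (\<pi> i u)) u)) \<and>
     (\<forall>i\<in>I. \<forall>j\<in>I. le i j \<longrightarrow>
        (\<forall>x\<in>topspace (X j). specialization L (\<epsilon> i (p i j x)) (\<epsilon> j x)))"

text \<open>
  The \<open>j\<close>-th coordinate of \<open>\<epsilon> i x\<close> is taken to be \<open>p j k (e i k x)\<close> for a common upper bound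
  \<open>k\<close> of \<open>i\<close> and \<open>j\<close>. Since \<open>p k m \<circ> e k m\<close> is the identity, this value does not change
  when \<open>k\<close> is replaced by a larger \<open>m\<close>, so by directedness it does not depend on \<open>k\<close> at all.
  The remaining properties can be checked one coordinate at a time, after moving far enough
  up in \<open>I\<close>, where they become the laws of the ep-system.
\<close>

lemma ep_system_limit_embeddings:
  assumes ep: "ep_system I le X p" and L: "proj_limit_copy I le X p L \<pi>"
  obtains \<epsilon> where "limit_embeddings I le X p L \<pi> \<epsilon>"
proof -
  have p: "projective_system I le X p"
    using ep by (simp add: ep_system_def)
  have refl: "le i i" if "i \<in> I" for i
    using p that by (auto simp: projective_system_def reflp_on_def)
  have trans: "le i k" if "i \<in> I" "j \<in> I" "k \<in> I" "le i j" "le j k" for i j k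
    using p that unfolding projective_system_def transp_on_def by blast
  obtain e where e:
    "\<forall>i\<in>I. \<forall>j\<in>I. le i j \<longrightarrow> continuous_map (X i) (X j) (e i j) \<and>
       (\<forall>x\<in>topspace (X i). p i j (e i j x) = x) \<and>
       (\<forall>x\<in>topspace (X j). specialization (X j) (e i j (p i j x)) x)"
    "\<forall>i\<in>I. \<forall>j\<in>I. \<forall>k\<in>I. le i j \<and> le j k \<longrightarrow> (\<forall>x\<in>topspace (X i). e j k (e i j x) = e i k x)"
    using ep unfolding ep_system_def by (elim conjE exE)
  have e_cont: "continuous_map (X i) (X j) (e i j)" if "i \<in> I" "j \<in> I" "le i j" for i j
    using e(1) that by blast
  have pe: "p i j (e i j x) = x" if "i \<in> I" "j \<in> I" "le i j" "x \<in> topspace (X i)" for i j x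
    using e(1) that by blast
  have ep_le: "specialization (X j) (e i j (p i j x)) x"
    if "i \<in> I" "j \<in> I" "le i j" "x \<in> topspace (X j)" for i j x
    using e(1) that by blast
  have ee: "e j k (e i j x) = e i k x"
    if "i \<in> I" "j \<in> I" "k \<in> I" "le i j" "le j k" "x \<in> topspace (X i)" for i j k x
    using e(2) that by blast
  have p_mem: "p i j x \<in> topspace (X i)"
    if "i \<in> I" "j \<in> I" "le i j" "x \<in> topspace (X j)" for i j x
    using projective_system_continuous [OF p that(1-3)] that(4) by (auto simp: continuous_map_def)
  have e_mem: "e i j x \<in> topspace (X j)"
    if "i \<in> I" "j \<in> I" "le i j" "x \<in> topspace (X i)" for i j x
    using e_cont [OF that(1-3)] that(4) by (auto simp: continuous_map_def)
  have up: "p j k (e i k x) = p j m (e i m x)"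
    if "i \<in> I" "j \<in> I" "k \<in> I" "m \<in> I" "le i k" "le j k" "le k m" "x \<in> topspace (X i)"
    for i j k m x
  proof -
    have "p j m (e i m x) = p j k (p k m (e k m (e i k x)))"
      using that trans [of i k m] e_mem by (simp add: projective_system_comp [OF p] ee)
    then show ?thesis
      using that e_mem pe by simp
  qed
  have indep: "p j k (e i k x) = p j m (e i m x)"
    if "i \<in> I" "j \<in> I" "k \<in> I" "m \<in> I" "le i k" "le j k" "le i m" "le j m" "x \<in> topspace (X i)"
    for i j k m x
  proof -
    obtain n where "n \<in> I" "le k n" "le m n"
      using projective_system_upper_bound [OF p \<open>k \<in> I\<close> \<open>m \<in> I\<close>] .
    then show ?thesis
      using that up [of i j k n x] up [of i j m n x] by simp
  qed
  have "\<exists>\<epsilon>. continuous_map (X i) L \<epsilon> \<and>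
      (\<forall>j\<in>I. \<forall>k\<in>I. \<forall>x\<in>topspace (X i). le i k \<longrightarrow> le j k \<longrightarrow> \<pi> j (\<epsilon> x) = p j k (e i k x))"
    if i: "i \<in> I" for i
  proof -
    have "\<forall>j\<in>I. \<exists>k\<in>I. le i k \<and> le j k"
      using projective_system_upper_bound [OF p i] by metis
    then obtain b where b: "\<And>j. j \<in> I \<Longrightarrow> b j \<in> I" "\<And>j. j \<in> I \<Longrightarrow> le i (b j)"
        "\<And>j. j \<in> I \<Longrightarrow> le j (b j)"
      by metis
    define f where "f j = p j (b j) \<circ> e i (b j)" for j
    have f: "f j x = p j k (e i k x)"
      if "j \<in> I" "k \<in> I" "le i k" "le j k" "x \<in> topspace (X i)" for j k x
      using that indep [of i j "b j" k x] b i by (simp add: f_def)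
    obtain \<epsilon> where "continuous_map (X i) L \<epsilon>"
        "\<And>j x. j \<in> I \<Longrightarrow> x \<in> topspace (X i) \<Longrightarrow> \<pi> j (\<epsilon> x) = f j x"
    proof (rule proj_limit_copy_lift [OF L, of "X i" f])
      show "continuous_map (X i) (X j) (f j)" if "j \<in> I" for j
        unfolding f_def
        by (rule continuous_map_compose [OF e_cont projective_system_continuous [OF p]])
          (use that b i in auto)
      show "p j m (f m x) = f j x" if "j \<in> I" "m \<in> I" "le j m" "x \<in> topspace (X i)" for j m x
      proof -
        have "le j (b m)"
          using that b trans by blast
        then show ?thesis
          using that b i e_mem f [of j "b m" x] f [of m "b m" x]
          by (simp add: projective_system_comp [OF p])
      qed
    qed blast
    with f show ?thesis
      by (intro exI [of _ \<epsilon>]) auto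
  qed
  then obtain \<epsilon> where \<epsilon>: "\<And>i. i \<in> I \<Longrightarrow> continuous_map (X i) L (\<epsilon> i)"
    and \<pi>\<epsilon>: "\<And>i j k x. i \<in> I \<Longrightarrow> j \<in> I \<Longrightarrow> k \<in> I \<Longrightarrow> x \<in> topspace (X i) \<Longrightarrow> le i k \<Longrightarrow> le j k \<Longrightarrow>
        \<pi> j (\<epsilon> i x) = p j k (e i k x)"
    by metis
  have \<epsilon>_mem: "\<epsilon> i x \<in> topspace L" if "i \<in> I" "x \<in> topspace (X i)" for i x
    using \<epsilon> [OF that(1)] that(2) by (auto simp: continuous_map_def)
  have \<pi>_mem: "\<pi> i u \<in> topspace (X i)" if "i \<in> I" "u \<in> topspace L" for i u
    using proj_limit_copy_continuous [OF L that(1)] that(2) by (auto simp: continuous_map_def)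
  have section_id: "\<pi> i (\<epsilon> i x) = x" if "i \<in> I" "x \<in> topspace (X i)" for i x
    using that refl pe \<pi>\<epsilon> [of i i i x] by simp
  have below_id: "specialization L (\<epsilon> i (\<pi> i u)) u" if i: "i \<in> I" and u: "u \<in> topspace L" for i u
  proof (rule specialization_proj_limit_copyI [OF p L _ u])
    show "\<epsilon> i (\<pi> i u) \<in> topspace L"
      using i u \<epsilon>_mem \<pi>_mem by simp
    show "specialization (X j) (\<pi> j (\<epsilon> i (\<pi> i u))) (\<pi> j u)" if j: "j \<in> I" for j
    proof -
      obtain k where k: "k \<in> I" "le i k" "le j k"
        using projective_system_upper_bound [OF p i j] .
      have "\<pi> j (\<epsilon> i (\<pi> i u)) = p j k (e i k (p i k (\<pi> k u)))"
        using \<pi>\<epsilon> [OF i j k(1)] k i u \<pi>_mem proj_limit_copy_cone [OF L i k(1,2) u] by simp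
      moreover have "\<pi> j u = p j k (\<pi> k u)"
        using proj_limit_copy_cone [OF L j k(1,3) u] by simp
      ultimately show ?thesis
        using specialization_continuous_map [OF projective_system_continuous [OF p j k(1,3)]]
          ep_le [OF i k(1,2)] \<pi>_mem k(1) u by simp
    qed
  qed
  have mono: "specialization L (\<epsilon> i (p i j x)) (\<epsilon> j x)"
    if ij: "i \<in> I" "j \<in> I" "le i j" and x: "x \<in> topspace (X j)" for i j x
  proof (rule specialization_proj_limit_copyI [OF p L])
    show "\<epsilon> i (p i j x) \<in> topspace L" "\<epsilon> j x \<in> topspace L"
      using ij x \<epsilon>_mem p_mem by simp_all
    show "specialization (X m) (\<pi> m (\<epsilon> i (p i j x))) (\<pi> m (\<epsilon> j x))" if m: "m \<in> I" for m
    proof -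
      obtain k where k: "k \<in> I" "le j k" "le m k"
        using projective_system_upper_bound [OF p ij(2) m] .
      have ik: "le i k"
        using trans [OF ij(1,2) k(1) ij(3) k(2)] .
      have "\<pi> m (\<epsilon> i (p i j x)) = p m k (e j k (e i j (p i j x)))"
        using \<pi>\<epsilon> [OF ij(1) m k(1) _ ik k(3)] ee [OF ij(1,2) k(1) ij(3) k(2)] p_mem [OF ij x] by simp
      moreover have "\<pi> m (\<epsilon> j x) = p m k (e j k x)"
        using \<pi>\<epsilon> [OF ij(2) m k(1) x k(2,3)] .
      ultimately show ?thesis
        using specialization_continuous_map [OF projective_system_continuous [OF p m k(1,3)]]
          specialization_continuous_map [OF e_cont [OF ij(2) k(1,2)]] ep_le [OF ij x] by simp
    qed
  qed
  have "limit_embeddings I le X p L \<pi> \<epsilon>"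
    using \<epsilon> section_id below_id mono by (auto simp: limit_embeddings_def)
  then show thesis
    using that by blast
qed

text \<open>
  An open set \<open>U\<close> of the limit is a union of preimages of open sets \<open>V\<close> of the \<open>X i\<close>, and such a
  preimage is contained in the \<open>i\<close>-th set below, because \<open>\<epsilon> i (\<pi> i u)\<close> and \<open>u\<close> have the same
  \<open>i\<close>-th coordinate. The gain over an arbitrary such union is that this one is directed, as
  Scott-continuity demands.
\<close>

lemma open_eq_directed_Union:
  assumes p: "projective_system I le X p" and L: "proj_limit_copy I le X p L \<pi>"
    and emb: "limit_embeddings I le X p L \<pi> \<epsilon>" and U: "openin L U"
  defines "\<U> \<equiv> \<lambda>i. {u \<in> topspace L. \<epsilon> i (\<pi> i u) \<in> U}"
  shows "U = (\<Union>i\<in>I. \<U> i)" and "directed_set (\<subseteq>) (\<U> ` I)"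
proof -
  show "U = (\<Union>i\<in>I. \<U> i)"
  proof
    show "U \<subseteq> (\<Union>i\<in>I. \<U> i)"
    proof
      fix u assume u: "u \<in> U"
      obtain i V where i: "i \<in> I" "openin (X i) V" "\<pi> i u \<in> V" "{w \<in> topspace L. \<pi> i w \<in> V} \<subseteq> U"
        using proj_limit_copy_neighbourhood [OF p L U u] .
      have uL: "u \<in> topspace L"
        using U u openin_subset by blast
      then have "\<pi> i u \<in> topspace (X i)"
        using proj_limit_copy_continuous [OF L i(1)] by (auto simp: continuous_map_def)
      then have "\<epsilon> i (\<pi> i u) \<in> topspace L" "\<pi> i (\<epsilon> i (\<pi> i u)) = \<pi> i u"
        using emb i(1) by (auto simp: limit_embeddings_def continuous_map_def)
      then have "\<epsilon> i (\<pi> i u) \<in> U"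
        using i(3,4) by auto
      then show "u \<in> (\<Union>i\<in>I. \<U> i)"
        using i(1) uL by (auto simp: \<U>_def)
    qed
    show "(\<Union>i\<in>I. \<U> i) \<subseteq> U"
    proof
      fix u assume "u \<in> (\<Union>i\<in>I. \<U> i)"
      then obtain i where "i \<in> I" "u \<in> topspace L" "\<epsilon> i (\<pi> i u) \<in> U"
        by (auto simp: \<U>_def)
      moreover from this have "specialization L (\<epsilon> i (\<pi> i u)) u"
        using emb by (simp add: limit_embeddings_def)
      ultimately show "u \<in> U"
        using U by (simp add: specialization_def)
    qed
  qed
  have mono: "\<U> i \<subseteq> \<U> j" if ij: "i \<in> I" "j \<in> I" "le i j" for i j
  proof
    fix u assume "u \<in> \<U> i"
    then have u: "u \<in> topspace L" "\<epsilon> i (\<pi> i u) \<in> U"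
      by (auto simp: \<U>_def)
    have "\<pi> j u \<in> topspace (X j)"
      using proj_limit_copy_continuous [OF L ij(2)] u(1) by (auto simp: continuous_map_def)
    then have "specialization L (\<epsilon> i (p i j (\<pi> j u))) (\<epsilon> j (\<pi> j u))"
      using emb ij by (simp add: limit_embeddings_def)
    then have "\<epsilon> j (\<pi> j u) \<in> U"
      using U u(2) proj_limit_copy_cone [OF L ij u(1)] by (simp add: specialization_def)
    then show "u \<in> \<U> j"
      using u(1) by (simp add: \<U>_def)
  qed
  have "I \<noteq> {}"
    using p by (auto simp: projective_system_def directed_set_def)
  then show "directed_set (\<subseteq>) (\<U> ` I)"
    using mono projective_system_upper_bound [OF p] unfolding directed_set_def
    by (smt (verit) image_iff image_is_empty)
qed


section \<open>Nice functors\<close>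

lemma scott_continuous_opens_Union:
  assumes "scott_continuous_opens X Y b" "\<And>U. U \<in> \<D> \<Longrightarrow> openin X U" "directed_set (\<subseteq>) \<D>"
  shows "b (\<Union>\<D>) = (\<Union>U\<in>\<D>. b U)"
proof -
  have "\<forall>\<D>. (\<forall>U\<in>\<D>. openin X U) \<and> directed_set (\<subseteq>) \<D> \<longrightarrow> b (\<Union>\<D>) = (\<Union>U\<in>\<D>. b U)"
    using assms(1) unfolding scott_continuous_opens_def by (elim conjE)
  from spec [OF this, of \<D>] assms(2,3) show ?thesis
    by blast
qed

definition nice_subbase ::
  "('u topology \<Rightarrow> 'v topology) \<Rightarrow>
   ('u topology \<Rightarrow> 'u topology \<Rightarrow> ('u \<Rightarrow> 'u) \<Rightarrow> 'v \<Rightarrow> 'v) \<Rightarrow> 'r set \<Rightarrow>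
   ('u topology \<Rightarrow> 'r \<Rightarrow> 'u set \<Rightarrow> 'v set) \<Rightarrow> bool" where
  "nice_subbase T Tm R B \<longleftrightarrow>
     (\<forall>X. is_subbase (T X) {B X r U |r U. r \<in> R \<and> openin X U}) \<and>
     (\<forall>X. \<forall>r\<in>R. scott_continuous_opens X (T X) (B X r)) \<and>
     (\<forall>X Y f. continuous_map X Y f \<longrightarrow>
        (\<forall>r\<in>R. \<forall>V. openin Y V \<longrightarrow>
           {z \<in> topspace (T X). Tm X Y f z \<in> B Y r V} = B X r {x \<in> topspace X. f x \<in> V}))"

lemma nice_functor_subbase:
  assumes "nice_functor T Tm R"
  obtains B where "nice_subbase T Tm R B"
proof -
  have "\<exists>B. nice_subbase T Tm R B"
    using assms unfolding nice_functor_def nice_subbase_def by (elim conjE)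
  then show thesis
    using that by blast
qed

lemma nice_subbase_is_subbase:
  assumes "nice_subbase T Tm R B"
  shows "is_subbase (T X) {B X r U |r U. r \<in> R \<and> openin X U}"
proof -
  have "\<forall>X. is_subbase (T X) {B X r U |r U. r \<in> R \<and> openin X U}"
    using assms unfolding nice_subbase_def by (elim conjE)
  then show ?thesis
    by (rule spec)
qed

lemma nice_subbase_scott_continuous:
  assumes "nice_subbase T Tm R B" "r \<in> R"
  shows "scott_continuous_opens X (T X) (B X r)"
proof -
  have "\<forall>X. \<forall>r\<in>R. scott_continuous_opens X (T X) (B X r)"
    using assms(1) unfolding nice_subbase_def by (elim conjE)
  with assms(2) show ?thesis
    by blast
qed

lemma nice_subbase_natural:
  assumes "nice_subbase T Tm R B" "continuous_map X Y f" "r \<in> R" "openin Y V"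
  shows "{z \<in> topspace (T X). Tm X Y f z \<in> B Y r V} = B X r {x \<in> topspace X. f x \<in> V}"
proof -
  have "\<forall>X Y f. continuous_map X Y f \<longrightarrow> (\<forall>r\<in>R. \<forall>V. openin Y V \<longrightarrow>
       {z \<in> topspace (T X). Tm X Y f z \<in> B Y r V} = B X r {x \<in> topspace X. f x \<in> V})"
    using assms(1) unfolding nice_subbase_def by (elim conjE)
  from this [rule_format, OF assms(2-)] show ?thesis .
qed

lemma top_functor_cong:
  assumes "top_functor T Tm" "continuous_map X Y f" "continuous_map X Y g"
    and "\<And>x. x \<in> topspace X \<Longrightarrow> f x = g x" "z \<in> topspace (T X)"
  shows "Tm X Y f z = Tm X Y g z"
proof -
  have "\<forall>X Y f g. continuous_map X Y f \<and> continuous_map X Y g \<and> (\<forall>x\<in>topspace X. f x = g x) \<longrightarrow>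
      (\<forall>z\<in>topspace (T X). Tm X Y f z = Tm X Y g z)"
    using assms(1) unfolding top_functor_def by (elim conjE)
  from this [rule_format, of X Y f g z] assms(2-) show ?thesis
    by simp
qed

lemma top_functor_comp:
  assumes "top_functor T Tm" "continuous_map X Y f" "continuous_map Y Z g" "z \<in> topspace (T X)"
  shows "Tm X Z (g \<circ> f) z = Tm Y Z g (Tm X Y f z)"
proof -
  have "\<forall>X Y Z f g. continuous_map X Y f \<and> continuous_map Y Z g \<longrightarrow>
      (\<forall>z\<in>topspace (T X). Tm X Z (g \<circ> f) z = Tm Y Z g (Tm X Y f z))"
    using assms(1) unfolding top_functor_def by (elim conjE)
  from this [rule_format, of X Y f Z g z] assms(2-) show ?thesis
    by simp
qed

lemma top_functor_continuous:
  assumes "top_functor T Tm" "continuous_map X Y f"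
  shows "continuous_map (T X) (T Y) (Tm X Y f)"
proof -
  have "\<forall>X Y f. continuous_map X Y f \<longrightarrow> continuous_map (T X) (T Y) (Tm X Y f)"
    using assms(1) unfolding top_functor_def by (elim conjE)
  with assms(2) show ?thesis
    by blast
qed

lemma top_functor_mem:
  assumes "top_functor T Tm" "continuous_map X Y f" "z \<in> topspace (T X)"
  shows "Tm X Y f z \<in> topspace (T Y)"
  using top_functor_continuous [OF assms(1,2)] assms(3) by (auto simp: continuous_map_def)

lemma nice_functor_imp_top_functor:
  assumes "nice_functor T Tm R"
  shows "top_functor T Tm"
  using assms unfolding nice_functor_def by (elim conjE)

text \<open>
  Naturality turns membership of \<open>Tm X Y f z\<close> in a subbasic open set into membership of \<open>z\<close> in
  the subbasic open set given by a preimage under \<open>f\<close>, and preimages of open sets grow with \<open>f\<close>.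
\<close>

lemma nice_functor_mono:
  assumes nice: "nice_functor T Tm R"
    and f: "continuous_map X Y f" and g: "continuous_map X Y g"
    and fg: "\<And>x. x \<in> topspace X \<Longrightarrow> specialization Y (f x) (g x)"
    and z: "z \<in> topspace (T X)"
  shows "specialization (T Y) (Tm X Y f z) (Tm X Y g z)"
proof -
  obtain B where B: "nice_subbase T Tm R B"
    using nice_functor_subbase [OF nice] .
  note sc = nice_subbase_scott_continuous [OF B] and nat = nice_subbase_natural [OF B]
  have T: "top_functor T Tm"
    using nice by (rule nice_functor_imp_top_functor)
  show ?thesis
  proof (rule specialization_subbaseI [OF nice_subbase_is_subbase [OF B]])
    show "Tm X Y f z \<in> topspace (T Y)" "Tm X Y g z \<in> topspace (T Y)"
      using top_functor_mem [OF T] f g z by auto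
    fix W assume "W \<in> {B Y r U |r U. r \<in> R \<and> openin Y U}" and fz: "Tm X Y f z \<in> W"
    then obtain r V where r: "r \<in> R" and V: "openin Y V" and W: "W = B Y r V"
      by blast
    have "{x \<in> topspace X. f x \<in> V} \<subseteq> {x \<in> topspace X. g x \<in> V}"
      using fg V by (auto simp: specialization_def)
    moreover have "openin X {x \<in> topspace X. f x \<in> V}" "openin X {x \<in> topspace X. g x \<in> V}"
      using f g V by (auto simp: continuous_map_def)
    ultimately have "B X r {x \<in> topspace X. f x \<in> V} \<subseteq> B X r {x \<in> topspace X. g x \<in> V}"
      using sc [OF r, of X] by (simp add: scott_continuous_opens_def)
    then show "Tm X Y g z \<in> W"
      using nat [OF f r V] nat [OF g r V] fz z W by blast
  qed
qed


section \<open>The comparison map\<close>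

text \<open>
  A subbasic open set \<open>B L r U\<close> is split by writing \<open>U\<close> as the directed union of its preimages
  under \<open>\<epsilon> i \<circ> \<pi> i\<close>. The result is a union over all indices, each with its own open set \<open>V i\<close>,
  and such a union is visibly the preimage of an open set of the limit of the \<open>T (X i)\<close>.
\<close>

lemma T_limit_initial_subbase:
  assumes nice: "nice_functor T Tm R"
    and p: "projective_system I le X p" and L: "proj_limit_copy I le X p L \<pi>"
    and emb: "limit_embeddings I le X p L \<pi> \<epsilon>"
  obtains \<S> where "is_subbase (T L) \<S>"
    and "\<forall>S\<in>\<S>. \<exists>V. (\<forall>i\<in>I. openin (T (X i)) (V i)) \<and>
           S = (\<Union>i\<in>I. {z \<in> topspace (T L). Tm L (X i) (\<pi> i) z \<in> V i})"
proof -
  obtain B where B: "nice_subbase T Tm R B"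
    using nice_functor_subbase [OF nice] .
  note sc = nice_subbase_scott_continuous [OF B] and nat = nice_subbase_natural [OF B]
  have \<pi>: "continuous_map L (X i) (\<pi> i)" if "i \<in> I" for i
    using proj_limit_copy_continuous [OF L that] .
  have \<epsilon>: "continuous_map (X i) L (\<epsilon> i)" if "i \<in> I" for i
    using emb that by (simp add: limit_embeddings_def)
  show thesis
  proof (rule that [OF nice_subbase_is_subbase [OF B]], rule ballI)
    fix S assume "S \<in> {B L r U |r U. r \<in> R \<and> openin L U}"
    then obtain r U where r: "r \<in> R" and U: "openin L U" and S: "S = B L r U"
      by blast
    let ?U = "\<lambda>i. {u \<in> topspace L. \<epsilon> i (\<pi> i u) \<in> U}"
    let ?V = "\<lambda>i. {x \<in> topspace (X i). \<epsilon> i x \<in> U}"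
    have V: "openin (X i) (?V i)" if "i \<in> I" for i
      using \<epsilon> [OF that] U by (simp add: continuous_map_def)
    have preimage: "{u \<in> topspace L. \<pi> i u \<in> ?V i} = ?U i" if "i \<in> I" for i
      using \<pi> [OF that] by (auto simp: continuous_map_def)
    have "openin L (?U i)" if "i \<in> I" for i
      using openin_continuous_map_preimage [OF \<pi> [OF that] V [OF that]] preimage [OF that] by simp
    then have "B L r (\<Union>(?U ` I)) = (\<Union>W\<in>?U ` I. B L r W)"
      by (intro scott_continuous_opens_Union [OF sc [OF r]] open_eq_directed_Union(2) [OF p L emb U])
        blast
    then have "S = (\<Union>i\<in>I. B L r (?U i))"
      using S open_eq_directed_Union(1) [OF p L emb U] by simp
    moreover have "B L r (?U i) = {z \<in> topspace (T L). Tm L (X i) (\<pi> i) z \<in> B (X i) r (?V i)}"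
      if "i \<in> I" for i
      using nat [OF \<pi> [OF that] r V [OF that]] preimage [OF that] by simp
    moreover have "openin (T (X i)) (B (X i) r (?V i))" if "i \<in> I" for i
      using sc [OF r, of "X i"] V [OF that] by (simp add: scott_continuous_opens_def)
    ultimately show "\<exists>V. (\<forall>i\<in>I. openin (T (X i)) (V i)) \<and>
           S = (\<Union>i\<in>I. {z \<in> topspace (T L). Tm L (X i) (\<pi> i) z \<in> V i})"
      by (intro exI [of _ "\<lambda>i. B (X i) r (?V i)"]) auto
  qed
qed

text \<open>
  This is where \<open>T L\<close> has to be a monotone convergence space: the preimage of \<open>z\<close> is the
  supremum of the approximations \<open>w i = T (\<epsilon> i) (z i)\<close>. One inequality between \<open>T (\<pi> i)\<close> of the
  supremum and \<open>z i\<close> comes from the upper bound property, the other from Scott-openness.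
\<close>

lemma image_limit_has_preimage:
  assumes nice: "nice_functor T Tm R"
    and p: "projective_system I le X p" and L: "proj_limit_copy I le X p L \<pi>"
    and emb: "limit_embeddings I le X p L \<pi> \<epsilon>"
    and t0: "\<And>i. i \<in> I \<Longrightarrow> t0_space (T (X i))"
    and mc: "monotone_convergence_space (T L)"
    and z: "z \<in> topspace (image_limit T Tm I le X p)"
  obtains w where "w \<in> topspace (T L)" "\<forall>i\<in>I. Tm L (X i) (\<pi> i) w = z i"
proof -
  have T: "top_functor T Tm"
    using nice by (rule nice_functor_imp_top_functor)
  have \<pi>: "continuous_map L (X i) (\<pi> i)" if "i \<in> I" for i
    using proj_limit_copy_continuous [OF L that] .
  have \<epsilon>: "continuous_map (X i) L (\<epsilon> i)" if "i \<in> I" for i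
    using emb that by (simp add: limit_embeddings_def)
  have zi: "z i \<in> topspace (T (X i))" if "i \<in> I" for i
    using z that by (auto simp: image_limit_def topspace_proj_limit)
  have zz: "Tm (X j) (X i) (p i j) (z j) = z i" if "i \<in> I" "j \<in> I" "le i j" for i j
    using z that by (auto simp: image_limit_def topspace_proj_limit)
  define w where "w i = Tm (X i) L (\<epsilon> i) (z i)" for i
  have w: "w i \<in> topspace (T L)" if "i \<in> I" for i
    using top_functor_mem [OF T \<epsilon> [OF that] zi [OF that]] by (simp add: w_def)
  have \<pi>w: "Tm L (X i) (\<pi> i) (w j) = z i" if ij: "i \<in> I" "j \<in> I" "le i j" for i j
  proof -
    have c: "continuous_map (X j) (X i) (p i j)"
      using projective_system_continuous [OF p ij] .
    have "Tm L (X i) (\<pi> i) (w j) = Tm (X j) (X i) (\<pi> i \<circ> \<epsilon> j) (z j)"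
      using top_functor_comp [OF T \<epsilon> [OF ij(2)] \<pi> [OF ij(1)] zi [OF ij(2)]] by (simp add: w_def)
    also have "\<dots> = Tm (X j) (X i) (p i j) (z j)"
    proof (rule top_functor_cong [OF T _ c _ zi [OF ij(2)]])
      show "continuous_map (X j) (X i) (\<pi> i \<circ> \<epsilon> j)"
        using continuous_map_compose [OF \<epsilon> [OF ij(2)] \<pi> [OF ij(1)]] .
      fix x assume x: "x \<in> topspace (X j)"
      then have "\<epsilon> j x \<in> topspace L" "\<pi> j (\<epsilon> j x) = x"
        using emb ij(2) by (auto simp: limit_embeddings_def continuous_map_def)
      then show "(\<pi> i \<circ> \<epsilon> j) x = p i j x"
        using proj_limit_copy_cone [OF L ij, of "\<epsilon> j x"] by simp
    qed
    finally show ?thesis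
      using zz [OF ij] by simp
  qed
  have w_mono: "specialization (T L) (w i) (w j)" if ij: "i \<in> I" "j \<in> I" "le i j" for i j
  proof -
    have c: "continuous_map (X j) (X i) (p i j)"
      using projective_system_continuous [OF p ij] .
    have "w i = Tm (X j) L (\<epsilon> i \<circ> p i j) (z j)"
      using top_functor_comp [OF T c \<epsilon> [OF ij(1)] zi [OF ij(2)]] zz [OF ij] by (simp add: w_def)
    moreover have "specialization (T L) (Tm (X j) L (\<epsilon> i \<circ> p i j) (z j)) (Tm (X j) L (\<epsilon> j) (z j))"
    proof (rule nice_functor_mono [OF nice _ \<epsilon> [OF ij(2)] _ zi [OF ij(2)]])
      show "continuous_map (X j) L (\<epsilon> i \<circ> p i j)"
        using continuous_map_compose [OF c \<epsilon> [OF ij(1)]] .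
      show "specialization L ((\<epsilon> i \<circ> p i j) x) (\<epsilon> j x)" if "x \<in> topspace (X j)" for x
        using emb ij that by (simp add: limit_embeddings_def)
    qed
    ultimately show ?thesis
      by (simp add: w_def)
  qed
  have sub: "w ` I \<subseteq> topspace (T L)"
    using w by blast
  have dir: "directed_set (specialization (T L)) (w ` I)"
  proof -
    have "I \<noteq> {}"
      using p by (auto simp: projective_system_def directed_set_def)
    moreover have "\<exists>k\<in>I. specialization (T L) (w i) (w k) \<and> specialization (T L) (w j) (w k)"
      if ij: "i \<in> I" "j \<in> I" for i j
    proof -
      obtain k where k: "k \<in> I" "le i k" "le j k"
        using projective_system_upper_bound [OF p ij] .
      then show ?thesis
        using w_mono [OF ij(1) k(1,2)] w_mono [OF ij(2) k(1,3)] by blast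
    qed
    ultimately show ?thesis
      by (auto simp: directed_set_def)
  qed
  obtain s where s: "is_supremum (topspace (T L)) (specialization (T L)) (w ` I) s"
  proof -
    have "\<forall>D. D \<subseteq> topspace (T L) \<and> directed_set (specialization (T L)) D \<longrightarrow>
        (\<exists>s. is_supremum (topspace (T L)) (specialization (T L)) D s)"
      using mc unfolding monotone_convergence_space_def by (elim conjE)
    from spec [OF this, of "w ` I"] sub dir show thesis
      using that by blast
  qed
  have sL: "s \<in> topspace (T L)"
    using s by (simp add: is_supremum_def)
  have "Tm L (X i) (\<pi> i) s = z i" if i: "i \<in> I" for i
  proof (rule specialization_antisym [OF t0 [OF i]])
    have c: "continuous_map (T L) (T (X i)) (Tm L (X i) (\<pi> i))"
      using top_functor_continuous [OF T \<pi> [OF i]] .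
    have "le i i"
      using p i by (auto simp: projective_system_def reflp_on_def)
    then have "Tm L (X i) (\<pi> i) (w i) = z i"
      using \<pi>w i by simp
    moreover have "specialization (T L) (w i) s"
      using s i by (simp add: is_supremum_def)
    ultimately show "specialization (T (X i)) (z i) (Tm L (X i) (\<pi> i) s)"
      using specialization_continuous_map [OF c, of "w i" s] by simp
    show "specialization (T (X i)) (Tm L (X i) (\<pi> i) s) (z i)"
      unfolding specialization_def
    proof (intro conjI allI impI zi [OF i] top_functor_mem [OF T \<pi> [OF i] sL])
      fix V assume V: "openin (T (X i)) V \<and> Tm L (X i) (\<pi> i) s \<in> V"
      let ?W = "{y \<in> topspace (T L). Tm L (X i) (\<pi> i) y \<in> V}"
      have "openin (T L) ?W"
        using c V by (simp add: continuous_map_def)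
      then have W: "scott_open (topspace (T L)) (specialization (T L)) ?W"
        using mc by (simp add: monotone_convergence_space_def)
      have "s \<in> ?W"
        using sL V by simp
      \<comment> \<open>The index \<open>j\<close> found here need not be above \<open>i\<close>, so \<open>w j\<close> is replaced by a later \<open>w k\<close>.\<close>
      then obtain j where j: "j \<in> I" "w j \<in> ?W"
        using scott_open_meets [OF W sub dir s] by blast
      obtain k where k: "k \<in> I" "le i k" "le j k"
        using projective_system_upper_bound [OF p i j(1)] .
      have "w k \<in> ?W"
        using specializationD [OF w_mono [OF j(1) k(1,3)] \<open>openin (T L) ?W\<close> j(2)] .
      then show "z i \<in> V"
        using \<pi>w [OF i k(1,2)] by simp
    qed
  qed
  then have "\<forall>i\<in>I. Tm L (X i) (\<pi> i) s = z i"
    by blast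
  with sL show thesis
    by (rule that)
qed

theorem proposition5p1:
  fixes T :: "'u topology \<Rightarrow> 'v topology"
    and Tm :: "'u topology \<Rightarrow> 'u topology \<Rightarrow> ('u \<Rightarrow> 'u) \<Rightarrow> 'v \<Rightarrow> 'v"
    and R :: "'r set"
    and I :: "'i set" and le :: "'i \<Rightarrow> 'i \<Rightarrow> bool"
    and X :: "'i \<Rightarrow> 'u topology" and p :: "'i \<Rightarrow> 'i \<Rightarrow> 'u \<Rightarrow> 'u"
    and L :: "'u topology" and \<pi> :: "'i \<Rightarrow> 'u \<Rightarrow> 'u"
    and \<phi> :: "'v \<Rightarrow> 'i \<Rightarrow> 'v"
  assumes "nice_functor T Tm R"
    and "ep_system I le X p"
    and "proj_limit_copy I le X p L \<pi>"
    and "comparison_map T Tm I le X p L \<pi> \<phi>"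
    and "\<And>i. i \<in> I \<Longrightarrow> t0_space (T (X i))"
    and "monotone_convergence_space (T L)"
  shows "homeomorphic_map (T L) (image_limit T Tm I le X p) \<phi>"
proof -
  let ?Z = "image_limit T Tm I le X p"
  note nice = assms(1) and L = assms(3)
  have p: "projective_system I le X p"
    using assms(2) by (simp add: ep_system_def)
  obtain \<epsilon> where emb: "limit_embeddings I le X p L \<pi> \<epsilon>"
    using ep_system_limit_embeddings [OF assms(2) L] .
  have \<phi>: "continuous_map (T L) ?Z \<phi>"
    and \<phi>_coord: "\<And>i y. i \<in> I \<Longrightarrow> y \<in> topspace (T L) \<Longrightarrow> \<phi> y i = Tm L (X i) (\<pi> i) y"
    using assms(4) by (simp_all add: comparison_map_def)
  obtain \<S> where sub: "is_subbase (T L) \<S>"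
    and \<S>: "\<forall>S\<in>\<S>. \<exists>V. (\<forall>i\<in>I. openin (T (X i)) (V i)) \<and>
           S = (\<Union>i\<in>I. {y \<in> topspace (T L). Tm L (X i) (\<pi> i) y \<in> V i})"
    using T_limit_initial_subbase [OF nice p L emb] .
  have initial: "\<exists>W. openin ?Z W \<and> S = {y \<in> topspace (T L). \<phi> y \<in> W}"
    if member: "S \<in> \<S>" for S
  proof -
    obtain V where V: "\<forall>i\<in>I. openin (T (X i)) (V i)"
      and S: "S = (\<Union>i\<in>I. {y \<in> topspace (T L). Tm L (X i) (\<pi> i) y \<in> V i})"
      using bspec [OF \<S> member] by blast
    let ?W = "\<Union>i\<in>I. {z \<in> topspace ?Z. z i \<in> V i}"
    have "continuous_map ?Z (T (X i)) (\<lambda>z. z i)" if "i \<in> I" for i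
      unfolding image_limit_def proj_limit_def
      using that by (intro continuous_map_from_subtopology continuous_map_product_projection)
    then have "openin ?Z {z \<in> topspace ?Z. z i \<in> V i}" if "i \<in> I" for i
      using openin_continuous_map_preimage that V by blast
    then have "openin ?Z ?W"
      by blast
    moreover have "\<phi> y \<in> topspace ?Z" if "y \<in> topspace (T L)" for y
      using \<phi> that by (auto simp: continuous_map_def)
    then have "S = {y \<in> topspace (T L). \<phi> y \<in> ?W}"
      using S \<phi>_coord by auto
    ultimately show ?thesis
      by blast
  qed
  have inj: "inj_on \<phi> (topspace (T L))"
  proof (rule inj_onI)
    fix x y assume xy: "x \<in> topspace (T L)" "y \<in> topspace (T L)" "\<phi> x = \<phi> y"
    have same: "x \<in> S \<longleftrightarrow> y \<in> S" if "S \<in> \<S>" for S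
      using initial [OF that] xy by auto
    have "t0_space (T L)"
      using assms(6) by (simp add: monotone_convergence_space_def)
    then show "x = y"
    proof (rule specialization_antisym)
      show "specialization (T L) x y"
        by (rule specialization_subbaseI [OF sub xy(1,2)]) (simp add: same)
      show "specialization (T L) y x"
        by (rule specialization_subbaseI [OF sub xy(2,1)]) (simp add: same)
    qed
  qed
  have surj: "\<phi> ` topspace (T L) = topspace ?Z"
  proof
    show "\<phi> ` topspace (T L) \<subseteq> topspace ?Z"
      using \<phi> by (rule continuous_map_image_subset_topspace)
    show "topspace ?Z \<subseteq> \<phi> ` topspace (T L)"
    proof
      fix z assume z: "z \<in> topspace ?Z"
      obtain w where w: "w \<in> topspace (T L)" "\<forall>i\<in>I. Tm L (X i) (\<pi> i) w = z i"
        using image_limit_has_preimage [OF nice p L emb assms(5,6) z] .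
      have "\<phi> w \<in> topspace ?Z"
        using \<phi> w(1) by (auto simp: continuous_map_def)
      then have "\<phi> w \<in> extensional I" "z \<in> extensional I"
        using z by (auto simp: image_limit_def topspace_proj_limit PiE_def)
      then have "\<phi> w = z"
        using w \<phi>_coord by (auto intro: extensionalityI)
      then show "z \<in> \<phi> ` topspace (T L)"
        using w(1) by blast
    qed
  qed
  let ?g = "inv_into (topspace (T L)) \<phi>"
  have g: "?g z \<in> topspace (T L)" "\<phi> (?g z) = z" if "z \<in> topspace ?Z" for z
    using that unfolding surj [symmetric] by (rule inv_into_into, rule f_inv_into_f)
  have "continuous_map ?Z (T L) ?g"
  proof (rule continuous_map_into_subbase [OF sub])
    show "?g \<in> topspace ?Z \<rightarrow> topspace (T L)"
      by (rule Pi_I) (rule g(1))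
    fix S assume "S \<in> \<S>"
    then obtain W where W: "openin ?Z W" "S = {y \<in> topspace (T L). \<phi> y \<in> W}"
      using initial by blast
    have "{z \<in> topspace ?Z. ?g z \<in> S} = topspace ?Z \<inter> W"
      unfolding W(2) by (auto simp: g)
    with W(1) show "openin ?Z {z \<in> topspace ?Z. ?g z \<in> S}"
      by (simp add: openin_Int)
  qed
  then have "homeomorphic_maps (T L) ?Z \<phi> ?g"
    using \<phi> inj g(2) by (simp add: homeomorphic_maps_def)
  then show ?thesis
    using homeomorphic_map_maps by blast
qed

end
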